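(* Let $P$ be a finite irreducible Markov chain on $V$ with stationary distribution $\pi$. For every nonempty proper subset $A\subset V$, \begin{align*} \tilde\phi(A)&\ge 1-\mathcal C_{\sqrt{a(1-a)}}(A)\ge 1-\sqrt{1-\tilde\phi(A)^2}\ge\tilde\phi(A)^2/2,\\ \tilde\phi(A)&\ge 1-\mathcal C_{a\log(1/a)}(A)\ge\frac{2\phi(A)^2}{\log(1/\pi(A))},\\ \tilde\phi(A)&\ge 1-\mathcal C_{a(1-a)}(A)\ge 4\,\tilde\phi(A)^2\,\pi(A)(1-\pi(A)). \end{align*}
   Context: $Q(A,B)=\sum_{x\in A,y\in B}\pi(x)P(x,y)$ and $Q(A,y)=Q(A,\{y\})$; $A_u=\{y\in V:Q(A,y)\ge u\,\pi(y)\}$ for $u\in[0,1]$; for $f:[0,1]\to[0,\infty)$, $\mathcal C_f(A)=\frac{\int_0^1 f(\pi(A_u))\,du}{f(\pi(A))}$, and a subscript such as $\sqrt{a(1-a)}$ denotes the function $f(a)=\sqrt{a(1-a)}$ (with $a\log(1/a)=0$ at $a=0$). For $0\le t<1$, $$\Psi(A,t)=\min_{\substack{B\subset V,\ v\in V\\ \pi(B)\le t,\ \pi(B\cup \{v\})>t}}\ Q(A,B)+(t-\pi(B))\frac{Q(A,v)}{\pi(v)},$$ $\Psi(A)=\Psi(A,\pi(A^c))$. The modified conductance is $\tilde\phi(A)=\frac{\Psi(A)}{\pi(A)\pi(A^c)}$, and $\phi(A)=\frac{\Psi(A)}{\pi(A)}$. *)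

theory Defs
  imports "HOL-Analysis.Analysis"
begin

text \<open>
  The state space \<open>V\<close> is the universe of a finite type \<open>'v\<close>; a transition kernel is a function
  \<open>P :: 'v \<Rightarrow> 'v \<Rightarrow> real\<close>, and the measure \<open>\<pi>(A)\<close> of a set of states is \<open>sum \<pi> A\<close>.
\<close>

definition markov_kernel :: "('v::finite \<Rightarrow> 'v \<Rightarrow> real) \<Rightarrow> bool" where
  "markov_kernel P \<longleftrightarrow> (\<forall>x y. 0 \<le> P x y) \<and> (\<forall>x. (\<Sum>y\<in>UNIV. P x y) = 1)"

primrec kernel_power :: "('v::finite \<Rightarrow> 'v \<Rightarrow> real) \<Rightarrow> nat \<Rightarrow> 'v \<Rightarrow> 'v \<Rightarrow> real" where
  "kernel_power P 0 x y = (if x = y then 1 else 0)"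
| "kernel_power P (Suc n) x y = (\<Sum>z\<in>UNIV. P x z * kernel_power P n z y)"

definition irreducible_kernel :: "('v::finite \<Rightarrow> 'v \<Rightarrow> real) \<Rightarrow> bool" where
  "irreducible_kernel P \<longleftrightarrow> (\<forall>x y. \<exists>n. kernel_power P n x y > 0)"

definition stationary_distribution :: "('v::finite \<Rightarrow> 'v \<Rightarrow> real) \<Rightarrow> ('v \<Rightarrow> real) \<Rightarrow> bool" where
  "stationary_distribution P \<pi> \<longleftrightarrow>
     (\<forall>x. 0 \<le> \<pi> x) \<and> (\<Sum>x\<in>UNIV. \<pi> x) = 1 \<and> (\<forall>y. (\<Sum>x\<in>UNIV. \<pi> x * P x y) = \<pi> y)"

definition ergodic_flow ::
  "('v::finite \<Rightarrow> 'v \<Rightarrow> real) \<Rightarrow> ('v \<Rightarrow> real) \<Rightarrow> 'v set \<Rightarrow> 'v set \<Rightarrow> real" where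
  "ergodic_flow P \<pi> A B = (\<Sum>x\<in>A. \<Sum>y\<in>B. \<pi> x * P x y)"

definition evolved_set ::
  "('v::finite \<Rightarrow> 'v \<Rightarrow> real) \<Rightarrow> ('v \<Rightarrow> real) \<Rightarrow> 'v set \<Rightarrow> real \<Rightarrow> 'v set" where
  "evolved_set P \<pi> A u = {y. ergodic_flow P \<pi> A {y} \<ge> u * \<pi> y}"

text \<open>
  As a function of \<open>u\<close>, the integrand below is a step function, so the integral always exists.
  For \<open>f = (\<lambda>a. a * ln (1 / a))\<close> the convention \<open>f 0 = 0\<close> holds automatically.
\<close>

definition f_congestion ::
  "('v::finite \<Rightarrow> 'v \<Rightarrow> real) \<Rightarrow> ('v \<Rightarrow> real) \<Rightarrow> (real \<Rightarrow> real) \<Rightarrow> 'v set \<Rightarrow> real" where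
  "f_congestion P \<pi> f A =
     integral {0..1} (\<lambda>u. f (sum \<pi> (evolved_set P \<pi> A u))) / f (sum \<pi> A)"

definition Psi_at ::
  "('v::finite \<Rightarrow> 'v \<Rightarrow> real) \<Rightarrow> ('v \<Rightarrow> real) \<Rightarrow> 'v set \<Rightarrow> real \<Rightarrow> real" where
  "Psi_at P \<pi> A t =
     Min {ergodic_flow P \<pi> A B + (t - sum \<pi> B) * (ergodic_flow P \<pi> A {v} / \<pi> v) | B v.
            sum \<pi> B \<le> t \<and> sum \<pi> (B \<union> {v}) > t}"

text \<open>
  \<^const>\<open>Min\<close> is meaningful here: the set is finite, and nonempty for every \<open>0 \<le> t < 1\<close>.
\<close>

lemma Psi_at_candidates:
  fixes \<pi> :: "'v::finite \<Rightarrow> real"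
  assumes "sum \<pi> UNIV = 1" and "0 \<le> t" and "t < 1"
  shows "finite {F B v | B v. sum \<pi> B \<le> t \<and> sum \<pi> (B \<union> {v}) > t}"
    and "{F B v | B v. sum \<pi> B \<le> t \<and> sum \<pi> (B \<union> {v}) > t} \<noteq> {}"
proof -
  have "finite ((\<lambda>(B, v). F B v) ` (UNIV :: ('v set \<times> 'v) set))"
    by simp
  then show "finite {F B v | B v. sum \<pi> B \<le> t \<and> sum \<pi> (B \<union> {v}) > t}"
    by (rule rev_finite_subset) auto
  show "{F B v | B v. sum \<pi> B \<le> t \<and> sum \<pi> (B \<union> {v}) > t} \<noteq> {}"
  proof
    assume "{F B v | B v. sum \<pi> B \<le> t \<and> sum \<pi> (B \<union> {v}) > t} = {}"
    then have "\<not> (sum \<pi> B \<le> t \<and> sum \<pi> (B \<union> {v}) > t)" for B v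
      by blast
    then have step: "sum \<pi> (insert v B) \<le> t" if "sum \<pi> B \<le> t" for B v
      using that by (metis Un_insert_right not_le sup_bot_right)
    have "sum \<pi> B \<le> t" for B
      using finite[of B] by (induction B) (simp add: \<open>0 \<le> t\<close>, rule step)
    then show False
      using assms by (metis not_le)
  qed
qed

definition Psi :: "('v::finite \<Rightarrow> 'v \<Rightarrow> real) \<Rightarrow> ('v \<Rightarrow> real) \<Rightarrow> 'v set \<Rightarrow> real" where
  "Psi P \<pi> A = Psi_at P \<pi> A (sum \<pi> (- A))"

definition modified_conductance ::
  "('v::finite \<Rightarrow> 'v \<Rightarrow> real) \<Rightarrow> ('v \<Rightarrow> real) \<Rightarrow> 'v set \<Rightarrow> real" where
  "modified_conductance P \<pi> A = Psi P \<pi> A / (sum \<pi> A * sum \<pi> (- A))"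

definition conductance ::
  "('v::finite \<Rightarrow> 'v \<Rightarrow> real) \<Rightarrow> ('v \<Rightarrow> real) \<Rightarrow> 'v set \<Rightarrow> real" where
  "conductance P \<pi> A = Psi P \<pi> A / sum \<pi> A"

end

theory Submission
  imports Defs
begin

text \<open>
  Put \<open>a = \<pi>(A)\<close> and \<open>g u = \<pi>(A\<^sub>u)\<close>, so that \<open>g\<close> has integral \<open>a\<close> over \<open>[0,1]\<close>. The key identity
  is that \<open>\<Psi>(A)\<close> is the integral \<open>D\<close> of the excess \<open>max (g u - a) 0\<close>. Hence a pointwise comparison of
  \<open>f\<close> with a function of \<open>x\<close> that is affine on either side of \<open>a\<close> integrates to a comparison of
  \<open>\<C>\<^sub>f(A)\<close> with an affine function of \<open>D\<close>. The chords from \<open>0\<close> to \<open>a\<close> and from \<open>a\<close> to \<open>1\<close> bound a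
  concave \<open>f\<close> from below; the upper bounds on \<open>f\<close> come from completing a square, with a free
  parameter that is optimised after integration.
\<close>

section \<open>Positivity of the stationary distribution\<close>

lemma kernel_power_nonneg:
  assumes "markov_kernel P"
  shows "0 \<le> kernel_power P n x y"
  using assms by (induction n arbitrary: x) (auto simp: markov_kernel_def intro!: sum_nonneg)

lemma stationary_kernel_power:
  assumes "stationary_distribution P \<pi>"
  shows "(\<Sum>x\<in>UNIV. \<pi> x * kernel_power P n x y) = \<pi> y"
proof (induction n)
  case 0
  have "(\<Sum>x\<in>UNIV. \<pi> x * kernel_power P 0 x y) = (\<Sum>x\<in>UNIV. if x = y then \<pi> x else 0)"
    by (rule sum.cong) auto
  then show ?case
    by simp
next
  case (Suc n)
  have "(\<Sum>x\<in>UNIV. \<pi> x * kernel_power P (Suc n) x y)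
      = (\<Sum>x\<in>UNIV. \<Sum>z\<in>UNIV. \<pi> x * P x z * kernel_power P n z y)"
    by (simp add: sum_distrib_left mult.assoc)
  also have "\<dots> = (\<Sum>z\<in>UNIV. (\<Sum>x\<in>UNIV. \<pi> x * P x z) * kernel_power P n z y)"
    by (subst sum.swap) (simp add: sum_distrib_right)
  also have "\<dots> = \<pi> y"
    using assms Suc by (simp add: stationary_distribution_def)
  finally show ?case .
qed

text \<open>Some state \<open>x\<close> carries mass, and irreducibility gives a power
  \<open>n\<close> that leads from \<open>x\<close> to \<open>y\<close>. As \<open>\<pi>\<close> is
  stationary for that power too, \<open>\<pi> y\<close> is at least the mass transported from
  \<open>x\<close>.\<close>

lemma stationary_distribution_pos:
  assumes "markov_kernel P" "irreducible_kernel P" "stationary_distribution P \<pi>"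
  shows "0 < \<pi> y"
proof -
  have nn: "0 \<le> \<pi> x" for x
    using assms(3) by (simp add: stationary_distribution_def)
  have "(\<Sum>x\<in>UNIV. \<pi> x) \<noteq> 0"
    using assms(3) by (simp add: stationary_distribution_def)
  then obtain x where "\<pi> x \<noteq> 0"
    by (meson sum.neutral)
  then have x: "0 < \<pi> x"
    using nn[of x] by simp
  obtain n where n: "0 < kernel_power P n x y"
    using assms(2) unfolding irreducible_kernel_def by blast
  have "0 < \<pi> x * kernel_power P n x y"
    using x n by simp
  also have "\<dots> \<le> (\<Sum>x\<in>UNIV. \<pi> x * kernel_power P n x y)"
    by (rule member_le_sum) (auto simp: nn kernel_power_nonneg[OF assms(1)])
  also have "\<dots> = \<pi> y"
    by (rule stationary_kernel_power[OF assms(3)])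
  finally show ?thesis .
qed

section \<open>Auxiliary integrals, weighted sums and scalar inequalities\<close>

lemma has_integral_indicator_atMost_unit:
  fixes r :: real
  assumes "0 \<le> r" "r \<le> 1"
  shows "((\<lambda>u. if u \<le> r then c else (0::real)) has_integral c * r) {0..1}"
proof -
  have "((\<lambda>u. c) has_integral c * r) {0..r}"
    using has_integral_const_real[of c 0 r] assms by (simp add: mult.commute)
  then have "((\<lambda>u. if u \<in> {0..r} then c else 0) has_integral c * r) {0..1}"
    using assms by (subst has_integral_restrict) auto
  then show ?thesis
    by (rule has_integral_eq[rotated]) auto
qed

text \<open>Since \<open>1 - w\<close> is nonnegative, the mass that \<open>w\<close> misses inside
  \<open>S\<close> is at most the mass that it misses altogether.\<close>

lemma sum_weights_le:
  fixes p w :: "'v::finite \<Rightarrow> real"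
  assumes "\<And>y. 0 \<le> p y" "\<And>y. w y \<le> 1"
  shows "sum p S - (sum p UNIV - (\<Sum>y\<in>UNIV. w y * p y)) \<le> (\<Sum>y\<in>S. w y * p y)"
proof -
  have "sum p S - (\<Sum>y\<in>S. w y * p y) = (\<Sum>y\<in>S. (1 - w y) * p y)"
    by (simp add: left_diff_distrib sum_subtractf)
  also have "\<dots> \<le> (\<Sum>y\<in>UNIV. (1 - w y) * p y)"
    by (rule sum_mono2) (auto simp: assms)
  also have "\<dots> = sum p UNIV - (\<Sum>y\<in>UNIV. w y * p y)"
    by (simp add: left_diff_distrib sum_subtractf)
  finally show ?thesis
    by simp
qed

text \<open>The difference \<open>k\<close> of \<open>y * ln y - y + 1\<close> and
  \<open>3 / 2 * ((y - 1)\<^sup>2 / (y + 2))\<close> is convex on the positive reals and vanishes at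
  1 together with its derivative. The affine factor \<open>2 * y + 4\<close> can be integrated
  exactly later, which preserves the sharp constant in Pinsker's inequality.\<close>

lemma entropy_ge_quadratic:
  fixes y :: real
  assumes "0 \<le> y"
  shows "3 * (y - 1)\<^sup>2 \<le> (2 * y + 4) * (y * ln y - y + 1)"
proof (cases "y = 0")
  case False
  then have y: "0 < y"
    using assms by simp
  define k where "k = (\<lambda>x::real. x * ln x - x + 1 - 3 / 2 * ((x - 1)\<^sup>2 / (x + 2)))"
  define k' where "k' = (\<lambda>x::real. ln x - 3 / 2 * ((x - 1) * (x + 5) / (x + 2)\<^sup>2))"
  define k'' where "k'' = (\<lambda>x::real. 1 / x - 27 / (x + 2) ^ 3)"
  have "k' 1 * (y - 1) \<le> k y - k 1"
  proof (rule f''_imp_f'[of "{0<..}" k k' k''])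
    fix x :: real
    assume "x \<in> {0<..}"
    then have x: "0 < x" "x + 2 \<noteq> 0"
      by auto
    show "DERIV k x :> k' x"
      unfolding k_def k'_def using x
      by (auto intro!: derivative_eq_intros)
        (simp add: divide_simps power2_eq_square, simp add: algebra_simps)
    show "DERIV k' x :> k'' x"
      unfolding k'_def k''_def using x
      by (auto intro!: derivative_eq_intros)
        (simp add: divide_simps, simp add: algebra_simps power2_eq_square power3_eq_cube power4_eq_xxxx)
    \<comment> \<open>This factorisation, with its double root at 1, is the sign of
      \<open>k''\<close>.\<close>
    have "(x + 2) ^ 3 - 27 * x = (x - 1)\<^sup>2 * (x + 8)"
      by (simp add: power2_eq_square power3_eq_cube algebra_simps)
    moreover have "0 \<le> (x - 1)\<^sup>2 * (x + 8)"
      using x by simp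
    ultimately have "27 * x \<le> (x + 2) ^ 3"
      by linarith
    then show "0 \<le> k'' x"
      unfolding k''_def using x by (simp add: field_simps)
  qed (use y in auto)
  then have "3 / 2 * ((y - 1)\<^sup>2 / (y + 2)) \<le> y * ln y - y + 1"
    by (simp add: k_def k'_def)
  then show ?thesis
    using y by (simp add: field_simps)
qed simp

text \<open>With \<open>z = \<bar>y - 1\<bar>\<close> and \<open>q = (2 * y + 4) / 3\<close>, the
  quadratic bound is \<open>z\<^sup>2 / q\<close>, and a square gives
  \<open>z\<^sup>2 / q \<ge> 2 * c * z - c\<^sup>2 * q\<close>. The latter is affine on either side
  of 1; \<open>c\<close> remains free.\<close>

lemma entropy_ge_abs:
  fixes y c :: real
  assumes "0 \<le> y"
  shows "2 * c * \<bar>y - 1\<bar> - c\<^sup>2 * (2 * y + 4) / 3 \<le> y * ln y - y + 1"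
proof -
  define q where "q = (2 * y + 4) / 3"
  have q: "0 < q"
    using assms by (simp add: q_def)
  have "0 \<le> (\<bar>y - 1\<bar> - c * q)\<^sup>2"
    by simp
  then have "q * (2 * c * \<bar>y - 1\<bar> - c\<^sup>2 * q) \<le> (y - 1)\<^sup>2"
    unfolding power2_diff power2_abs by (simp add: power2_eq_square algebra_simps)
  also have "\<dots> \<le> q * (y * ln y - y + 1)"
    using entropy_ge_quadratic[OF assms] by (simp add: q_def)
  finally show ?thesis
    using q by (simp add: q_def)
qed

lemma le_sqrt_one_minus_square:
  fixes C p :: real
  assumes p: "0 \<le> p" "p \<le> 1"
    and C: "\<And>s. 0 < s \<Longrightarrow> C \<le> (s * (1 + p) + (1 - p) / s) / 2"
  shows "C \<le> sqrt (1 - p\<^sup>2)"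
proof (cases "p = 1")
  case True
  \<comment> \<open>For \<open>p = 1\<close> the hypothesis reads \<open>C \<le> s\<close>; the
    infimum is approached only as \<open>s\<close> tends to 0.\<close>
  have "C \<le> 0 + e" if "0 < e" for e
    using C[OF that] True by simp
  then have "C \<le> 0"
    by (rule field_le_epsilon)
  then show ?thesis
    using True by simp
next
  case False
  define m n where "m = sqrt (1 - p)" and "n = sqrt (1 + p)"
  have mn: "0 < m" "0 < n" "m * m = 1 - p" "n * n = 1 + p"
    using p False by (auto simp: m_def n_def)
  \<comment> \<open>The choice \<open>s = m / n\<close> makes the two terms of the mean equal and so
    minimises it.\<close>
  have "C \<le> (m / n * (n * n) + m * m / (m / n)) / 2"
    using C[of "m / n"] mn by simp
  also have "\<dots> = m * n"
    using mn(1,2) by simp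
  also have "\<dots> = sqrt (1 - p\<^sup>2)"
    by (simp add: m_def n_def real_sqrt_mult[symmetric] power2_eq_square algebra_simps)
  finally show ?thesis .
qed

section \<open>The evolved sets and their measure\<close>

locale evolving_chain =
  fixes P :: "'v::finite \<Rightarrow> 'v \<Rightarrow> real" and \<pi> :: "'v \<Rightarrow> real" and A :: "'v set"
  assumes kernel: "markov_kernel P"
    and stat: "stationary_distribution P \<pi>"
    and pos: "\<And>y. 0 < \<pi> y"
    and nonempty: "A \<noteq> {}"
    and proper: "A \<noteq> UNIV"
begin

definition a :: real where "a = sum \<pi> A"

text \<open>The probability that the time-reversed chain steps from \<open>y\<close> into
  \<open>A\<close>. It is the largest level \<open>u\<close> at which \<open>y\<close> still belongs
  to the evolved set, so evolved sets are superlevel sets of \<open>r\<close>.\<close>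

definition r :: "'v \<Rightarrow> real" where "r y = ergodic_flow P \<pi> A {y} / \<pi> y"

definition g :: "real \<Rightarrow> real" where "g u = sum \<pi> (evolved_set P \<pi> A u)"

definition D :: real where "D = integral {0..1} (\<lambda>u. max (g u - a) 0)"

lemma nonneg: "0 \<le> \<pi> y"
  using pos[of y] by simp

lemma sum_UNIV: "sum \<pi> UNIV = 1"
  using stat by (simp add: stationary_distribution_def)

lemma sum_Compl: "sum \<pi> (- B) = 1 - sum \<pi> B"
  using sum_diff[of UNIV B \<pi>] by (simp add: Compl_eq_Diff_UNIV sum_UNIV)

lemma sum_bounds: "0 \<le> sum \<pi> B" "sum \<pi> B \<le> 1"
  using sum_mono2[of UNIV B \<pi>] by (auto simp: sum_UNIV nonneg sum_nonneg)

lemma sum_pos: "B \<noteq> {} \<Longrightarrow> 0 < sum \<pi> B"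
  by (simp add: pos sum_pos)

lemma a_pos: "0 < a"
  unfolding a_def by (rule sum_pos[OF nonempty])

lemma a_less_1: "a < 1"
  using sum_pos[of "- A"] proper sum_Compl[of A] by (auto simp: a_def)

lemma g_bounds: "0 \<le> g u" "g u \<le> 1"
  by (auto simp: g_def sum_bounds)

lemma flow_r: "ergodic_flow P \<pi> A {y} = \<pi> y * r y"
  using pos[of y] by (simp add: r_def)

lemma flow_sum: "ergodic_flow P \<pi> A B = (\<Sum>y\<in>B. \<pi> y * r y)"
  unfolding flow_r[symmetric] by (simp add: ergodic_flow_def) (rule sum.swap)

lemma r_bounds: "0 \<le> r y" "r y \<le> 1"
proof -
  have P: "0 \<le> P x z" for x z
    using kernel by (simp add: markov_kernel_def)
  have "(\<Sum>x\<in>A. \<pi> x * P x y) \<le> (\<Sum>x\<in>UNIV. \<pi> x * P x y)"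
    by (rule sum_mono2) (auto simp: P nonneg)
  also have "\<dots> = \<pi> y"
    using stat by (simp add: stationary_distribution_def)
  finally show "r y \<le> 1"
    using pos[of y] by (simp add: r_def ergodic_flow_def)
  show "0 \<le> r y"
    by (auto simp: r_def ergodic_flow_def P nonneg intro!: divide_nonneg_nonneg sum_nonneg)
qed

lemma evolved_set_eq: "evolved_set P \<pi> A u = {y. u \<le> r y}"
  unfolding evolved_set_def flow_r using pos by (auto simp: mult.commute)

lemma sum_r: "(\<Sum>y\<in>UNIV. \<pi> y * r y) = a"
proof -
  have "(\<Sum>y\<in>UNIV. \<pi> y * r y) = (\<Sum>x\<in>A. \<pi> x * (\<Sum>y\<in>UNIV. P x y))"
    by (simp add: flow_sum[symmetric] ergodic_flow_def sum_distrib_left)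
  also have "\<dots> = a"
    using kernel by (simp add: markov_kernel_def a_def)
  finally show ?thesis .
qed

section \<open>Integration over the level \<open>u\<close>\<close>

text \<open>Layer-cake formula: \<open>y\<close> is counted exactly for the levels in
  \<open>[0, r y]\<close>, an interval of length \<open>r y\<close>.\<close>

lemma has_integral_sum_evolved_set:
  "((\<lambda>u. \<Sum>y\<in>evolved_set P \<pi> A u. c y) has_integral (\<Sum>y\<in>UNIV. c y * r y)) {0..1}"
proof -
  have "((\<lambda>u. \<Sum>y\<in>UNIV. if u \<le> r y then c y else 0) has_integral (\<Sum>y\<in>UNIV. c y * r y)) {0..1}"
    by (intro has_integral_sum has_integral_indicator_atMost_unit r_bounds) auto
  then show ?thesis
    by (simp add: evolved_set_eq sum.If_cases)
qed

lemma g_has_integral: "(g has_integral a) {0..1}"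
  using has_integral_sum_evolved_set[of \<pi>] by (simp add: sum_r g_def[abs_def])

text \<open>The evolved set takes finitely many values, each on an intersection of rays. Any
  function of it is therefore a bounded Borel step function, whatever \<open>h\<close> is.\<close>

lemma integrable_evolved_set:
  "(\<lambda>u. h (evolved_set P \<pi> A u) :: real) integrable_on {0..1}"
proof (rule measurable_bounded_by_integrable_imp_integrable)
  have [measurable]: "{u. evolved_set P \<pi> A u = B} \<in> sets borel" for B
  proof -
    have "{u. evolved_set P \<pi> A u = B} = (\<Inter>y\<in>B. {..r y}) \<inter> (\<Inter>y\<in>- B. {r y<..})"
      unfolding evolved_set_eq set_eq_iff Int_iff INT_iff Compl_iff mem_Collect_eq
        atMost_iff greaterThan_iff not_le[symmetric] by blast
    also have "\<dots> \<in> sets borel"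
      by (intro sets.Int sets.countable_INT'') auto
    finally show ?thesis .
  qed
  have "(\<lambda>u. h (evolved_set P \<pi> A u))
      = (\<lambda>u. \<Sum>B\<in>UNIV. h B * indicator {u. evolved_set P \<pi> A u = B} u)"
    by (simp add: indicator_def if_distrib cong: if_cong)
  also have "\<dots> \<in> borel_measurable borel"
    by measurable
  finally have "(\<lambda>u. h (evolved_set P \<pi> A u)) \<in> borel_measurable lebesgue"
    by (auto intro: measurable_completion)
  then show "(\<lambda>u. h (evolved_set P \<pi> A u)) \<in> borel_measurable (lebesgue_on {0..1})"
    by (rule measurable_restrict_space1)
  show "(\<lambda>u. Max (range (\<lambda>B. \<bar>h B\<bar>))) integrable_on {0..1::real}"
    by (rule integrable_const_ivl)
  show "norm (h (evolved_set P \<pi> A u)) \<le> Max (range (\<lambda>B. \<bar>h B\<bar>))" for u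
    by (auto intro: Max_ge)
qed auto

lemma integrable_g: "(\<lambda>u. F (g u) :: real) integrable_on {0..1}"
  unfolding g_def by (rule integrable_evolved_set)

lemma excess_has_integral: "((\<lambda>u. max (g u - a) 0) has_integral D) {0..1}"
  unfolding D_def using integrable_g[of "\<lambda>x. max (x - a) 0"] by (rule integrable_integral)

text \<open>As \<open>g\<close> has mean \<open>a\<close>, the term with \<open>q\<close> integrates
  to 0. In the comparisons below \<open>q\<close> can thus be any slope to the left of
  \<open>a\<close>, while \<open>k\<close> is the change of slope at \<open>a\<close>.\<close>

lemma piecewise_linear_has_integral:
  "((\<lambda>u. p + q * (g u - a) + k * max (g u - a) 0) has_integral p + k * D) {0..1}"
proof -
  have c: "((\<lambda>u::real. c) has_integral c) {0..1}" for c :: real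
    using has_integral_const_real[of c 0 1] by simp
  have "((\<lambda>u. p + q * (g u - a) + k * max (g u - a) 0)
      has_integral p + q * (a - a) + k * D) {0..1}"
    by (intro has_integral_add has_integral_mult_right has_integral_diff
        g_has_integral excess_has_integral c)
  then show ?thesis
    by simp
qed

lemma integral_le:
  assumes "\<And>x. 0 \<le> x \<Longrightarrow> x \<le> 1 \<Longrightarrow> F x \<le> p + q * (x - a) + k * max (x - a) 0"
  shows "integral {0..1} (\<lambda>u. F (g u)) \<le> p + k * D"
  by (rule has_integral_le[OF integrable_integral[OF integrable_g]
        piecewise_linear_has_integral[of p q k]])
    (simp add: assms g_bounds)

lemma integral_ge:
  assumes "\<And>x. 0 \<le> x \<Longrightarrow> x \<le> 1 \<Longrightarrow> p + q * (x - a) + k * max (x - a) 0 \<le> F x"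
  shows "p + k * D \<le> integral {0..1} (\<lambda>u. F (g u))"
  by (rule has_integral_le[OF piecewise_linear_has_integral[of p q k]
        integrable_integral[OF integrable_g]])
    (simp add: assms g_bounds)

section \<open>\<open>Psi\<close> as the mean excess of the evolved set\<close>

text \<open>A fractional set: \<open>B\<close> together with the share of \<open>v\<close> that
  fills the mass up to \<open>1 - a\<close>. The constraints on \<open>B\<close> and
  \<open>v\<close> in the minimum place this share between 0 and 1.\<close>

definition weight :: "'v set \<Rightarrow> 'v \<Rightarrow> 'v \<Rightarrow> real" where
  "weight B v y = (if y \<in> B then 1 else if y = v then (1 - a - sum \<pi> B) / \<pi> v else 0)"

lemma candidate_eq:
  assumes "v \<notin> B"
  shows "ergodic_flow P \<pi> A B + (sum \<pi> (- A) - sum \<pi> B) * (ergodic_flow P \<pi> A {v} / \<pi> v)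
      = (\<Sum>y\<in>UNIV. weight B v y * \<pi> y * r y)"
    and "(\<Sum>y\<in>UNIV. weight B v y * \<pi> y) = 1 - a"
proof -
  have split: "(\<Sum>y\<in>UNIV. weight B v y * k y) = sum k B + (1 - a - sum \<pi> B) / \<pi> v * k v" for k
  proof -
    have "(\<Sum>y\<in>UNIV. weight B v y * k y) = (\<Sum>y\<in>insert v B. weight B v y * k y)"
      by (rule sum.mono_neutral_right) (auto simp: weight_def)
    also have "\<dots> = weight B v v * k v + (\<Sum>y\<in>B. weight B v y * k y)"
      using assms(1) by simp
    also have "(\<Sum>y\<in>B. weight B v y * k y) = sum k B"
      by (rule sum.cong) (auto simp: weight_def)
    finally show ?thesis
      using assms(1) by (simp add: weight_def)
  qed
  show "ergodic_flow P \<pi> A B + (sum \<pi> (- A) - sum \<pi> B) * (ergodic_flow P \<pi> A {v} / \<pi> v)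
      = (\<Sum>y\<in>UNIV. weight B v y * \<pi> y * r y)"
    using split[of "\<lambda>y. \<pi> y * r y"] pos[of v]
    by (simp add: flow_sum mult.assoc sum_Compl a_def)
  show "(\<Sum>y\<in>UNIV. weight B v y * \<pi> y) = 1 - a"
    using split[of \<pi>] pos[of v] by simp
qed

text \<open>
  The minimum defining \<open>Psi\<close> is a fractional knapsack problem: a candidate is a \<open>weight\<close> \<open>w\<close> with
  values in \<open>[0,1]\<close> and \<open>\<pi>\<close>-mass \<open>1 - a\<close>, its cost is the integral over \<open>u\<close> of the
  \<open>w\<close>-mass of the evolved set, and the greedy choice is optimal simultaneously for every \<open>u\<close>.
\<close>

lemma Psi_eq: "Psi P \<pi> A = D"
proof -
  define cost where "cost = (\<lambda>B v. ergodic_flow P \<pi> A B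
      + (sum \<pi> (- A) - sum \<pi> B) * (ergodic_flow P \<pi> A {v} / \<pi> v))"
  define S where "S = {cost B v | B v. sum \<pi> B \<le> sum \<pi> (- A) \<and> sum \<pi> (B \<union> {v}) > sum \<pi> (- A)}"
  have Psi: "Psi P \<pi> A = Min S"
    by (simp add: Psi_def Psi_at_def S_def cost_def)
  have t: "sum \<pi> (- A) = 1 - a"
    by (simp add: sum_Compl a_def)
  have fin: "finite S"
    unfolding S_def
    by (rule Psi_at_candidates) (use sum_UNIV t a_pos a_less_1 in auto)
  have notin: "v \<notin> B" if "sum \<pi> B \<le> sum \<pi> (- A)" "sum \<pi> (B \<union> {v}) > sum \<pi> (- A)" for B v
  proof
    assume "v \<in> B"
    then have "B \<union> {v} = B"
      by auto
    then show False
      using that by simp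
  qed
  have w01: "0 \<le> weight B v y" "weight B v y \<le> 1"
    if "sum \<pi> B \<le> sum \<pi> (- A)" "sum \<pi> (B \<union> {v}) > sum \<pi> (- A)" for B v y
    using that notin[OF that] pos[of v] by (auto simp: weight_def t)
  have lower: "D \<le> z" if "z \<in> S" for z
  proof -
    obtain B v where z: "z = cost B v"
      and Bv: "sum \<pi> B \<le> sum \<pi> (- A)" "sum \<pi> (B \<union> {v}) > sum \<pi> (- A)"
      using \<open>z \<in> S\<close> unfolding S_def by blast
    note ce = candidate_eq[OF notin[OF Bv]]
    have "D \<le> (\<Sum>y\<in>UNIV. weight B v y * \<pi> y * r y)"
    proof (rule has_integral_le[OF excess_has_integral has_integral_sum_evolved_set])
      fix u :: real
      \<comment> \<open>The weight misses mass \<open>a\<close> in total, hence at most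
        \<open>a\<close> within the evolved set.\<close>
      have "g u - a \<le> (\<Sum>y\<in>evolved_set P \<pi> A u. weight B v y * \<pi> y)"
        using sum_weights_le[of \<pi> "weight B v" "evolved_set P \<pi> A u"] w01[OF Bv]
        by (simp add: ce(2) sum_UNIV nonneg g_def)
      moreover have "0 \<le> (\<Sum>y\<in>evolved_set P \<pi> A u. weight B v y * \<pi> y)"
        by (intro sum_nonneg mult_nonneg_nonneg w01[OF Bv] nonneg)
      ultimately show "max (g u - a) 0 \<le> (\<Sum>y\<in>evolved_set P \<pi> A u. weight B v y * \<pi> y)"
        by simp
    qed
    then show ?thesis
      unfolding z cost_def ce(1) .
  qed
  have "D \<in> S"
  proof -
    \<comment> \<open>Greedy choice: \<open>L\<close> consists of the initial segments in the order
      of increasing \<open>r\<close> that fit into mass \<open>1 - a\<close>. Take \<open>B\<close>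
      of maximal cardinality and \<open>v\<close> next in the order; adding \<open>v\<close> must
      overshoot, or \<open>insert v B\<close> would be a larger member of \<open>L\<close>.\<close>
    define L where "L = {B. sum \<pi> B \<le> sum \<pi> (- A) \<and> (\<forall>x\<in>B. \<forall>y\<in>- B. r x \<le> r y)}"
    have "{} \<in> L"
      by (simp add: L_def sum_bounds)
    then have "Max (card ` L) \<in> card ` L"
      by (intro Max_in) auto
    then obtain B where B: "B \<in> L" "card B = Max (card ` L)"
      by auto
    have maxB: "card B' \<le> card B" if "B' \<in> L" for B'
      unfolding B(2) using that by (intro Max_ge) auto
    have "B \<noteq> UNIV"
      using B(1) a_pos by (auto simp: L_def sum_UNIV t)
    then have "Min (r ` (- B)) \<in> r ` (- B)"
      by (intro Min_in) auto
    then obtain v where v: "v \<notin> B" "r v = Min (r ` (- B))"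
      by auto
    have minv: "r v \<le> r y" if "y \<notin> B" for y
      unfolding v(2) using that by (intro Min_le) auto
    have Bv: "sum \<pi> B \<le> sum \<pi> (- A)" "sum \<pi> (B \<union> {v}) > sum \<pi> (- A)"
    proof -
      show "sum \<pi> B \<le> sum \<pi> (- A)"
        using B(1) by (simp add: L_def)
      have "insert v B \<notin> L"
        using maxB[of "insert v B"] v(1) by auto
      then show "sum \<pi> (B \<union> {v}) > sum \<pi> (- A)"
        using B(1) minv unfolding L_def by auto
    qed
    note ce = candidate_eq[OF v(1)]
    have le: "r x \<le> r v" if "x \<in> B" for x
      using B(1) v(1) that by (auto simp: L_def)
    \<comment> \<open>For \<open>u \<le> r v\<close> the evolved set contains the complement of
      \<open>B\<close>, so all of the missed mass \<open>a\<close> lies in it. For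
      \<open>u > r v\<close> it is disjoint from the support of the weight, and the general estimate
      then forces \<open>g u \<le> a\<close>.\<close>
    have "(\<Sum>y\<in>evolved_set P \<pi> A u. weight B v y * \<pi> y) = max (g u - a) 0" for u
    proof (cases "u \<le> r v")
      case True
      have "(\<Sum>y\<in>evolved_set P \<pi> A u. (1 - weight B v y) * \<pi> y) = (\<Sum>y\<in>UNIV. (1 - weight B v y) * \<pi> y)"
        by (rule sum.mono_neutral_left)
          (use True minv in \<open>force simp: weight_def evolved_set_eq not_le\<close>)+
      then have "g u - (\<Sum>y\<in>evolved_set P \<pi> A u. weight B v y * \<pi> y) = a"
        by (simp add: left_diff_distrib sum_subtractf ce(2) sum_UNIV g_def)
      moreover have "0 \<le> (\<Sum>y\<in>evolved_set P \<pi> A u. weight B v y * \<pi> y)"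
        by (intro sum_nonneg mult_nonneg_nonneg w01[OF Bv] nonneg)
      ultimately show ?thesis
        by simp
    next
      case False
      have "(\<Sum>y\<in>evolved_set P \<pi> A u. weight B v y * \<pi> y) = 0"
        by (rule sum.neutral) (use False le in \<open>force simp: weight_def evolved_set_eq\<close>)
      moreover have "g u - a \<le> (\<Sum>y\<in>evolved_set P \<pi> A u. weight B v y * \<pi> y)"
        using sum_weights_le[of \<pi> "weight B v" "evolved_set P \<pi> A u"] w01[OF Bv]
        by (simp add: ce(2) sum_UNIV nonneg g_def)
      ultimately show ?thesis
        by simp
    qed
    then have "((\<lambda>u. max (g u - a) 0) has_integral (\<Sum>y\<in>UNIV. weight B v y * \<pi> y * r y)) {0..1}"
      using has_integral_sum_evolved_set[of "\<lambda>y. weight B v y * \<pi> y"] by simp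
    then have "D = cost B v"
      unfolding cost_def ce(1) using has_integral_unique excess_has_integral by blast
    then show ?thesis
      using Bv unfolding S_def by blast
  qed
  then show ?thesis
    unfolding Psi using fin lower by (intro Min_eqI)
qed

section \<open>Conductances and congestions in terms of \<open>D\<close>\<close>

lemma D_bounds: "0 \<le> D" "D \<le> a * (1 - a)"
proof -
  show "0 \<le> D"
    unfolding D_def by (rule integral_nonneg[OF excess_has_integral[THEN has_integral_integrable]]) simp
  \<comment> \<open>The convex function \<open>max (x - a) 0\<close> lies below its chord
    \<open>(1 - a) * x\<close> over \<open>[0,1]\<close>.\<close>
  have "0 + 1 * D \<le> integral {0..1} (\<lambda>u. (1 - a) * g u)"
  proof (rule integral_ge[where q = 0])
    fix x :: real
    assume x: "0 \<le> x" "x \<le> 1"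
    have "0 \<le> (1 - a) * x" "0 \<le> a * (1 - x)"
      using x a_pos a_less_1 by simp_all
    then show "0 + 0 * (x - a) + 1 * max (x - a) 0 \<le> (1 - a) * x"
      by (simp add: algebra_simps)
  qed
  also have "\<dots> = a * (1 - a)"
    using integral_unique[OF g_has_integral] by (simp add: mult.commute)
  finally show "D \<le> a * (1 - a)"
    by simp
qed

lemma modified_conductance_eq: "modified_conductance P \<pi> A = D / (a * (1 - a))"
  by (simp add: modified_conductance_def Psi_eq a_def sum_Compl)

lemma conductance_eq: "conductance P \<pi> A = D / a"
  by (simp add: conductance_def Psi_eq a_def)

lemma f_congestion_eq: "f_congestion P \<pi> f A = integral {0..1} (\<lambda>u. f (g u)) / f a"
  by (simp add: f_congestion_def g_def a_def)

lemma modified_conductance_bounds: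
  "0 \<le> modified_conductance P \<pi> A" "modified_conductance P \<pi> A \<le> 1"
  using D_bounds a_pos a_less_1 by (auto simp: modified_conductance_eq divide_le_eq)

text \<open>With denominators cleared, \<open>right\<close> and \<open>left\<close> place
  \<open>f\<close> above the chords from \<open>(a, f a)\<close> to \<open>(1, 0)\<close> and to
  \<open>(0, 0)\<close>. Their slopes differ by \<open>- f a / (a * (1 - a))\<close>, and this
  factor turns \<open>D\<close> into the modified conductance.\<close>

lemma congestion_lower_bound:
  assumes fa: "0 < f a"
    and right: "\<And>x. a \<le> x \<Longrightarrow> x \<le> 1 \<Longrightarrow> f a * (1 - x) \<le> f x * (1 - a)"
    and left: "\<And>x. 0 \<le> x \<Longrightarrow> x \<le> a \<Longrightarrow> f a * x \<le> f x * a"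
  shows "1 - f_congestion P \<pi> f A \<le> modified_conductance P \<pi> A"
proof -
  have "f a + (- f a / (a * (1 - a))) * D \<le> integral {0..1} (\<lambda>u. f (g u))"
  proof (rule integral_ge[where q = "f a / a"])
    fix x :: real
    assume x: "0 \<le> x" "x \<le> 1"
    show "f a + f a / a * (x - a) + (- f a / (a * (1 - a))) * max (x - a) 0 \<le> f x"
    proof (cases "a \<le> x")
      case True
      have "f a + f a / a * (x - a) + (- f a / (a * (1 - a))) * (x - a) = f a * (1 - x) / (1 - a)"
        using a_pos a_less_1 by (simp add: field_simps)
      also have "\<dots> \<le> f x"
        using right[OF True x(2)] a_less_1 by (simp add: divide_le_eq)
      finally show ?thesis
        using True by simp
    next
      case False
      have "f a + f a / a * (x - a) = f a * x / a"
        using a_pos by (simp add: field_simps)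
      also have "\<dots> \<le> f x"
        using left[of x] x False a_pos by (simp add: divide_le_eq)
      finally show ?thesis
        using False by simp
    qed
  qed
  also have "f a + (- f a / (a * (1 - a))) * D = f a * (1 - modified_conductance P \<pi> A)"
    by (simp add: modified_conductance_eq algebra_simps)
  finally show ?thesis
    using fa by (simp add: f_congestion_eq field_simps)
qed

abbreviation phi :: real where "phi \<equiv> modified_conductance P \<pi> A"

section \<open>The function \<open>sqrt (a * (1 - a))\<close>\<close>

lemma congestion_sqrt_lower_bound:
  "1 - f_congestion P \<pi> (\<lambda>a. sqrt (a * (1 - a))) A \<le> phi"
proof (rule congestion_lower_bound)
  have root: "sqrt (x * (1 - x)) * y = sqrt (x * (1 - x) * y\<^sup>2)" if "0 \<le> y" for x y :: real
    using that by (simp add: real_sqrt_mult)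
  fix x :: real
  show "sqrt (a * (1 - a)) * (1 - x) \<le> sqrt (x * (1 - x)) * (1 - a)" if "a \<le> x" "x \<le> 1"
  proof -
    have "0 \<le> (1 - a) * (1 - x)"
      using that a_less_1 by simp
    moreover have "a * (1 - x) \<le> x * (1 - a)"
      using that by (simp add: algebra_simps)
    ultimately have "a * (1 - x) * ((1 - a) * (1 - x)) \<le> x * (1 - a) * ((1 - a) * (1 - x))"
      by (rule mult_right_mono[rotated])
    then have "sqrt (a * (1 - a) * (1 - x)\<^sup>2) \<le> sqrt (x * (1 - x) * (1 - a)\<^sup>2)"
      by (simp add: power2_eq_square mult_ac)
    then show ?thesis
      using root[of "1 - x" a] root[of "1 - a" x] that a_less_1 by simp
  qed
  show "sqrt (a * (1 - a)) * x \<le> sqrt (x * (1 - x)) * a" if "0 \<le> x" "x \<le> a"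
  proof -
    have "0 \<le> a * x"
      using that a_pos by simp
    moreover have "x * (1 - a) \<le> a * (1 - x)"
      using that by (simp add: algebra_simps)
    ultimately have "x * (1 - a) * (a * x) \<le> a * (1 - x) * (a * x)"
      by (rule mult_right_mono[rotated])
    then have "sqrt (a * (1 - a) * x\<^sup>2) \<le> sqrt (x * (1 - x) * a\<^sup>2)"
      by (simp add: power2_eq_square mult_ac)
    then show ?thesis
      using root[of x a] root[of a x] that a_pos by simp
  qed
qed (use a_pos a_less_1 in auto)

text \<open>The arithmetic-geometric mean inequality is applied to \<open>x / a\<close> and
  \<open>(1 - x) / (1 - a)\<close>, scaled by \<open>m\<close> and \<open>1 / m\<close>. Taking
  \<open>m = s\<close> for \<open>x \<ge> a\<close> and \<open>m = 1 / s\<close> below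
  \<open>a\<close> gives two lines that meet at \<open>a\<close>; the best \<open>s\<close> is
  chosen after integration.\<close>

lemma congestion_sqrt_upper_bound:
  "f_congestion P \<pi> (\<lambda>a. sqrt (a * (1 - a))) A \<le> sqrt (1 - phi\<^sup>2)"
proof (rule le_sqrt_one_minus_square[OF modified_conductance_bounds])
  fix s :: real
  assume s: "0 < s"
  define F where "F = sqrt (a * (1 - a))"
  have F: "0 < F"
    using a_pos a_less_1 by (simp add: F_def)
  have amgm: "sqrt (x * (1 - x)) \<le> F * ((m * x / a + (1 - x) / (m * (1 - a))) / 2)"
    if "0 < m" "0 \<le> x" "x \<le> 1" for m x
  proof -
    have "sqrt (x * (1 - x)) = sqrt (a * (1 - a) * (m * x / a * ((1 - x) / (m * (1 - a)))))"
      using that a_pos a_less_1 by simp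
    also have "\<dots> = F * sqrt (m * x / a * ((1 - x) / (m * (1 - a))))"
      unfolding F_def by (rule real_sqrt_mult)
    also have "\<dots> \<le> F * ((m * x / a + (1 - x) / (m * (1 - a))) / 2)"
      using that a_pos a_less_1 F by (intro mult_left_mono arith_geo_mean_sqrt) auto
    finally show ?thesis .
  qed
  have "integral {0..1} (\<lambda>u. sqrt (g u * (1 - g u)))
      \<le> F * (s + 1 / s) / 2 + F * (s - 1 / s) / (2 * a * (1 - a)) * D"
  proof (rule integral_le[where q = "F * (1 / (s * a) - s / (1 - a)) / 2"])
    fix x :: real
    assume x: "0 \<le> x" "x \<le> 1"
    define R where "R = F * (s + 1 / s) / 2 + F * (1 / (s * a) - s / (1 - a)) / 2 * (x - a)
      + F * (s - 1 / s) / (2 * a * (1 - a)) * max (x - a) 0"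
    have nz: "s \<noteq> 0" "a \<noteq> 0" "1 - a \<noteq> 0"
      using s a_pos a_less_1 by auto
    have "sqrt (x * (1 - x)) \<le> R"
    proof (cases "a \<le> x")
      case True
      have "R = F * ((s * x / a + (1 - x) / (s * (1 - a))) / 2)"
        unfolding R_def using True nz by (simp add: divide_simps) (simp add: algebra_simps)
      then show ?thesis
        using amgm[OF s x] by simp
    next
      case False
      have "R = F * ((1 / s * x / a + (1 - x) / (1 / s * (1 - a))) / 2)"
        unfolding R_def using False nz by (simp add: divide_simps) (simp add: algebra_simps)
      then show ?thesis
        using amgm[OF _ x, of "1 / s"] s by simp
    qed
    then show "sqrt (x * (1 - x)) \<le> F * (s + 1 / s) / 2
        + F * (1 / (s * a) - s / (1 - a)) / 2 * (x - a)
        + F * (s - 1 / s) / (2 * a * (1 - a)) * max (x - a) 0"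
      by (simp add: R_def)
  qed
  also have "\<dots> = F * ((s * (1 + phi) + (1 - phi) / s) / 2)"
    using s a_pos a_less_1
    by (simp add: modified_conductance_eq divide_simps) (simp add: algebra_simps)
  finally show "f_congestion P \<pi> (\<lambda>a. sqrt (a * (1 - a))) A \<le> (s * (1 + phi) + (1 - phi) / s) / 2"
    using F by (simp add: f_congestion_eq F_def[symmetric] pos_divide_le_eq mult.commute)
qed

section \<open>The function \<open>a * ln (1 / a)\<close>\<close>

lemma congestion_entropy_lower_bound:
  "1 - f_congestion P \<pi> (\<lambda>a. a * ln (1 / a)) A \<le> phi"
proof (rule congestion_lower_bound)
  fix x :: real
  show "a * ln (1 / a) * (1 - x) \<le> x * ln (1 / x) * (1 - a)" if "a \<le> x" "x \<le> 1"
  proof -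
    have x: "0 < x"
      using that a_pos by simp
    \<comment> \<open>The chord bound comes from \<open>ln z \<le> z - 1\<close> at
      \<open>z = x / a\<close> and \<open>z = x\<close>, weighted by \<open>a * (1 - x)\<close> and
      \<open>x - a\<close>; the terms without logarithms cancel.\<close>
    have "ln (x / a) \<le> x / a - 1"
      using x a_pos by (intro ln_le_minus_one) auto
    then have "a * ln x + a - x \<le> a * ln a"
      using x a_pos by (simp add: ln_div field_simps)
    then have "(1 - x) * (a * ln x + a - x) \<le> (1 - x) * (a * ln a)"
      using that by (intro mult_left_mono) auto
    moreover have "(x - a) * ln x \<le> (x - a) * (x - 1)"
      using that x by (intro mult_left_mono ln_le_minus_one) auto
    ultimately have "x * ln x * (1 - a) \<le> a * ln a * (1 - x)"
      by (simp add: algebra_simps)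
    then show ?thesis
      using x a_pos by (simp add: ln_div)
  qed
  show "a * ln (1 / a) * x \<le> x * ln (1 / x) * a" if "0 \<le> x" "x \<le> a"
  proof (cases "x = 0")
    case False
    then have "ln x \<le> ln a"
      using that a_pos by simp
    then have "a * x * ln x \<le> a * x * ln a"
      using that a_pos by (intro mult_left_mono) auto
    then show ?thesis
      using that False a_pos by (simp add: ln_div mult_ac)
  qed simp
qed (use a_pos a_less_1 in \<open>simp add: ln_div mult_pos_neg\<close>)

text \<open>This is Pinsker's inequality for the density \<open>g / a\<close> on the unit interval.\<close>

lemma congestion_entropy_upper_bound:
  "2 * (conductance P \<pi> A)\<^sup>2 / ln (1 / a) \<le> 1 - f_congestion P \<pi> (\<lambda>a. a * ln (1 / a)) A"
proof -
  \<comment> \<open>This value minimises the integrated bound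
    \<open>a * ln (1 / a) + 2 * a * c\<^sup>2 - 4 * c * D\<close>; it equals the
    conductance.\<close>
  define c where "c = D / a"
  have l: "0 < ln (1 / a)"
    using a_pos a_less_1 by (simp add: ln_div)
  have "integral {0..1} (\<lambda>u. g u * ln (1 / g u)) \<le> (a * ln (1 / a) + 2 * a * c\<^sup>2) + (- 4 * c) * D"
  proof (rule integral_le[where q = "- ln a - 1 + 2 * c\<^sup>2 / 3 + 2 * c"])
    fix x :: real
    assume x: "0 \<le> x" "x \<le> 1"
    have "a * (2 * c * \<bar>x / a - 1\<bar> - c\<^sup>2 * (2 * (x / a) + 4) / 3)
        \<le> a * (x / a * ln (x / a) - x / a + 1)"
      using x a_pos by (intro mult_left_mono entropy_ge_abs) auto
    moreover have "a * (2 * c * \<bar>x / a - 1\<bar> - c\<^sup>2 * (2 * (x / a) + 4) / 3)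
        = 2 * c * \<bar>x - a\<bar> - c\<^sup>2 * (2 * x + 4 * a) / 3"
    proof -
      have "a * \<bar>x / a - 1\<bar> = \<bar>x - a\<bar>"
        using a_pos by (simp add: field_simps flip: abs_mult_pos')
      moreover have "a * (2 * (x / a) + 4) = 2 * x + 4 * a"
        using a_pos by (simp add: field_simps)
      moreover have "a * (2 * c * z - c\<^sup>2 * q / 3) = 2 * c * (a * z) - c\<^sup>2 * (a * q) / 3" for z q
        by (simp add: right_diff_distrib)
      ultimately show ?thesis
        by simp
    qed
    moreover have "a * (x / a * ln (x / a) - x / a + 1) = x * ln (x / a) - x + a"
      using a_pos by (simp add: distrib_left right_diff_distrib)
    moreover have "x * ln (x / a) = - (x * ln (1 / x)) - x * ln a"
      using x a_pos by (cases "x = 0") (simp_all add: ln_div algebra_simps)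
    moreover have "\<bar>x - a\<bar> = 2 * max (x - a) 0 - (x - a)"
      by (auto simp: max_def)
    ultimately have "2 * c * (2 * max (x - a) 0 - (x - a)) - c\<^sup>2 * (2 * x + 4 * a) / 3
        \<le> - (x * ln (1 / x)) - x * ln a - x + a"
      by simp
    moreover have la: "ln (1 / a) = - ln a"
      using a_pos by (simp add: ln_div)
    ultimately show "x * ln (1 / x) \<le> (a * ln (1 / a) + 2 * a * c\<^sup>2)
        + (- ln a - 1 + 2 * c\<^sup>2 / 3 + 2 * c) * (x - a) + (- 4 * c) * max (x - a) 0"
      by (simp add: la algebra_simps add_divide_distrib diff_divide_distrib)
  qed
  also have "\<dots> = a * ln (1 / a) * (1 - 2 * c\<^sup>2 / ln (1 / a))"
    using a_pos l by (simp add: c_def right_diff_distrib power2_eq_square)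
  finally have "f_congestion P \<pi> (\<lambda>a. a * ln (1 / a)) A \<le> 1 - 2 * c\<^sup>2 / ln (1 / a)"
    using a_pos l by (simp add: f_congestion_eq pos_divide_le_eq mult.commute)
  then show ?thesis
    by (simp add: conductance_eq c_def)
qed

section \<open>The function \<open>a * (1 - a)\<close>\<close>

lemma congestion_quadratic_lower_bound:
  "1 - f_congestion P \<pi> (\<lambda>a. a * (1 - a)) A \<le> phi"
proof (rule congestion_lower_bound)
  fix x :: real
  show "a * (1 - a) * (1 - x) \<le> x * (1 - x) * (1 - a)" if "a \<le> x" "x \<le> 1"
  proof -
    have "a * ((1 - a) * (1 - x)) \<le> x * ((1 - a) * (1 - x))"
      using that a_less_1 by (intro mult_right_mono) auto
    then show ?thesis
      by (simp add: mult_ac)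
  qed
  show "a * (1 - a) * x \<le> x * (1 - x) * a" if "0 \<le> x" "x \<le> a"
  proof -
    have "(1 - a) * (a * x) \<le> (1 - x) * (a * x)"
      using that a_pos by (intro mult_right_mono) auto
    then show ?thesis
      by (simp add: mult_ac)
  qed
qed (use a_pos a_less_1 in auto)

text \<open>The integral of \<open>g u * (1 - g u)\<close> is \<open>a * (1 - a)\<close> minus the
  variance of \<open>g\<close>. The mean of \<open>\<bar>g u - a\<bar>\<close> is
  \<open>2 * D\<close>, so the variance is at least \<open>4 * D\<^sup>2\<close> by Cauchy-Schwarz,
  here in the form of a completed square.\<close>

lemma congestion_quadratic_upper_bound:
  "4 * phi\<^sup>2 * a * (1 - a) \<le> 1 - f_congestion P \<pi> (\<lambda>a. a * (1 - a)) A"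
proof -
  have "integral {0..1} (\<lambda>u. g u * (1 - g u)) \<le> (a * (1 - a) + 4 * D\<^sup>2) + (- 8 * D) * D"
  proof (rule integral_le[where q = "1 - 2 * a + 4 * D"])
    fix x :: real
    have "0 \<le> (\<bar>x - a\<bar> - 2 * D)\<^sup>2"
      by simp
    then have "4 * D * \<bar>x - a\<bar> - 4 * D\<^sup>2 \<le> (x - a)\<^sup>2"
      by (simp add: power2_diff power_mult_distrib algebra_simps)
    moreover have "\<bar>x - a\<bar> = 2 * max (x - a) 0 - (x - a)"
      by (auto simp: max_def)
    ultimately have "4 * D * (2 * max (x - a) 0 - (x - a)) - 4 * D\<^sup>2 \<le> (x - a)\<^sup>2"
      by simp
    then show "x * (1 - x) \<le> (a * (1 - a) + 4 * D\<^sup>2) + (1 - 2 * a + 4 * D) * (x - a)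
        + (- 8 * D) * max (x - a) 0"
      by (simp add: power2_eq_square algebra_simps)
  qed
  also have "\<dots> = a * (1 - a) * (1 - 4 * phi\<^sup>2 * a * (1 - a))"
    using a_pos a_less_1
    by (simp add: modified_conductance_eq right_diff_distrib[of "a * (1 - a)"] power2_eq_square)
  finally have "f_congestion P \<pi> (\<lambda>a. a * (1 - a)) A \<le> 1 - 4 * phi\<^sup>2 * a * (1 - a)"
    using a_pos a_less_1 by (simp add: f_congestion_eq pos_divide_le_eq mult.commute)
  then show ?thesis
    by simp
qed

end

theorem theorem3p4p1:
  fixes P :: "'v::finite \<Rightarrow> 'v \<Rightarrow> real" and \<pi> :: "'v \<Rightarrow> real" and A :: "'v set"
  assumes "markov_kernel P" and "irreducible_kernel P" and "stationary_distribution P \<pi>"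
    and "A \<noteq> {}" and "A \<noteq> UNIV"
  shows
    "modified_conductance P \<pi> A \<ge> 1 - f_congestion P \<pi> (\<lambda>a. sqrt (a * (1 - a))) A \<and>
     1 - f_congestion P \<pi> (\<lambda>a. sqrt (a * (1 - a))) A
       \<ge> 1 - sqrt (1 - (modified_conductance P \<pi> A)\<^sup>2) \<and>
     1 - sqrt (1 - (modified_conductance P \<pi> A)\<^sup>2) \<ge> (modified_conductance P \<pi> A)\<^sup>2 / 2 \<and>
     modified_conductance P \<pi> A \<ge> 1 - f_congestion P \<pi> (\<lambda>a. a * ln (1 / a)) A \<and>
     1 - f_congestion P \<pi> (\<lambda>a. a * ln (1 / a)) A
       \<ge> 2 * (conductance P \<pi> A)\<^sup>2 / ln (1 / sum \<pi> A) \<and>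
     modified_conductance P \<pi> A \<ge> 1 - f_congestion P \<pi> (\<lambda>a. a * (1 - a)) A \<and>
     1 - f_congestion P \<pi> (\<lambda>a. a * (1 - a)) A
       \<ge> 4 * (modified_conductance P \<pi> A)\<^sup>2 * sum \<pi> A * (1 - sum \<pi> A)"
proof -
  interpret evolving_chain P \<pi> A
    using assms stationary_distribution_pos by unfold_locales auto
  \<comment> \<open>The geometric mean of \<open>1\<close> and \<open>1 - phi\<^sup>2\<close> is at
    most their arithmetic mean \<open>1 - phi\<^sup>2 / 2\<close>.\<close>
  have "1 - sqrt (1 - phi\<^sup>2) \<ge> phi\<^sup>2 / 2"
    using arith_geo_mean_sqrt[of 1 "1 - phi\<^sup>2"] modified_conductance_bounds
    by (simp add: power_le_one field_simps)
  then show ?thesis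
    using congestion_sqrt_lower_bound congestion_sqrt_upper_bound
      congestion_entropy_lower_bound congestion_entropy_upper_bound
      congestion_quadratic_lower_bound congestion_quadratic_upper_bound
    by (simp add: a_def)
qed

end
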